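(* Let $d\ge 1$, $k\ge 1$, and let $H_0\in\mathbb{R}^{d\times d}$ be symmetric. Let $w_0,\dots,w_k\in\mathbb{R}^d$ and $g_0,\dots,g_k\in\mathbb{R}^d$, put $s_i=w_{i+1}-w_i$ and $y_i=g_{i+1}-g_i$ for $0\le i\le k-1$, and let $v_0,\dots,v_{k-1}\in\mathbb{R}^d$ be arbitrary vectors with $v_i^Ty_i\neq 0$ for all $0\le i\le k-1$. Let $H_1,\dots,H_k$ be generated from $H_0$ by the recursive update $$H_{i+1}=H_i+\frac{(s_i-H_iy_i)v_i^T+v_i(s_i-H_iy_i)^T}{v_i^Ty_i}-\frac{(s_i-H_iy_i)^Ty_i}{(v_i^Ty_i)^2}\,v_iv_i^T,\qquad 0\le i\le k-1.$$ Then $$H_k=H_0+\begin{bmatrix}V_k & S_k-H_0Y_k\end{bmatrix}\begin{bmatrix}0_{k\times k} & R_k^{VY}\\ (R_k^{VY})^T & R_k+R_k^T-(D_k+Y_k^TH_0Y_k)\end{bmatrix}^{-1}\begin{bmatrix}V_k^T\\ (S_k-H_0Y_k)^T\end{bmatrix}.$$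
   Context: $S_k=[s_0\ \cdots\ s_{k-1}]$, $Y_k=[y_0\ \cdots\ y_{k-1}]$, $V_k=[v_0\ \cdots\ v_{k-1}]$ are the $d\times k$ matrices with the indicated columns. With rows and columns indexed by $0,\dots,k-1$: $D_k\in\mathbb{R}^{k\times k}$ is the diagonal matrix with $(D_k)_{ii}=s_i^Ty_i$; $R_k\in\mathbb{R}^{k\times k}$ is the upper triangular part (including the diagonal) of $S_k^TY_k$, i.e. $(R_k)_{ij}=s_i^Ty_j$ for $i\le j$ and $0$ otherwise; $R_k^{VY}\in\mathbb{R}^{k\times k}$ is the upper triangular part (including the diagonal) of $V_k^TY_k$, i.e. $(R_k^{VY})_{ij}=v_i^Ty_j$ for $i\le j$ and $0$ otherwise. (In the application $w_i$ are optimization iterates and $g_i$ gradients at $w_i$.) *)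

theory Defs
  imports
    Complex_Main
    "Jordan_Normal_Form.Matrix"
    "Jordan_Normal_Form.Gauss_Jordan_Elimination"
begin

definition outer_prod :: "real vec \<Rightarrow> real vec \<Rightarrow> real mat" where
  "outer_prod u v = mat (dim_vec u) (dim_vec v) (\<lambda>(i, j). u $ i * v $ j)"

definition upper_part :: "real mat \<Rightarrow> real mat" where
  "upper_part A = mat (dim_row A) (dim_col A) (\<lambda>(i, j). if i \<le> j then A $$ (i, j) else 0)"

(* Column-wise counterpart of append_rows from Jordan_Normal_Form.Matrix. *)
definition append_cols :: "real mat \<Rightarrow> real mat \<Rightarrow> real mat" (infixr "@\<^sub>c" 65) where
  "A @\<^sub>c B = four_block_mat A B (0\<^sub>m 0 (dim_col A)) (0\<^sub>m 0 (dim_col B))"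

(* The next iterate obtained from H and the triple (s, y, v); in the formula
   r = s - H y is the residual of the secant equation. *)
definition qn_update :: "real mat \<Rightarrow> real vec \<Rightarrow> real vec \<Rightarrow> real vec \<Rightarrow> real mat" where
  "qn_update H s y v =
     (let r = s - H *\<^sub>v y in
        H + (1 / (v \<bullet> y)) \<cdot>\<^sub>m (outer_prod r v + outer_prod v r)
          - ((r \<bullet> y) / (v \<bullet> y)\<^sup>2) \<cdot>\<^sub>m outer_prod v v)"

(* mat_inverse is option-valued; the result is the inverse only for invertible A,
   and is unspecified otherwise. *)
definition inv_mat :: "real mat \<Rightarrow> real mat" where
  "inv_mat A = the (mat_inverse A)"

end

theory Submission
  imports Defs "Jordan_Normal_Form.Determinant"
begin

text \<open>
  Write \<open>U\<close> for the upper triangular part of \<open>V\<^sup>T Y\<close>, \<open>Z = S - H\<^sub>0 Y\<close> for the matrix of initial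
  residuals, and \<open>C\<close> for the lower right block of the middle matrix. Since the diagonal entries
  \<open>v\<^sub>i \<bullet> y\<^sub>i\<close> of \<open>U\<close> do not vanish, \<open>U\<close> has an inverse \<open>B\<close>, and the middle matrix, whose upper left
  block is zero, can be inverted blockwise (\<open>saddle_block_right_inverse\<close>):
  its inverse has the blocks \<open>- B\<^sup>T C B\<close>, \<open>B\<^sup>T\<close>, \<open>B\<close> and \<open>0\<close>. With \<open>Q = V B\<^sup>T\<close> the claim becomes
  \<open>H\<^sub>k = H\<^sub>0 + Z Q\<^sup>T + Q Z\<^sup>T - Q C Q\<^sup>T\<close>, where \<open>Q\<close> is determined by \<open>Q U\<^sup>T = V\<close>. No inverse is left
  in this form, so it can be proved by induction on \<open>k\<close>.

  For the induction (\<open>compact_form_by_dual_vectors\<close>) put \<open>q = v\<^sub>k / (v\<^sub>k \<bullet> y\<^sub>k)\<close> and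
  \<open>P = I - q y\<^sub>k\<^sup>T\<close>. Bordering \<open>U\<close> by one more row and column turns the solution \<open>Q\<close> of \<open>Q U\<^sup>T = V\<close>
  into \<open>[P Q, q]\<close>. For symmetric matrices the update itself reads
  \<open>H\<^sub>k\<^sub>+\<^sub>1 - H\<^sub>0 = P (H\<^sub>k - H\<^sub>0) P\<^sup>T + q z\<^sub>k\<^sup>T + z\<^sub>k q\<^sup>T - (z\<^sub>k \<bullet> y\<^sub>k) q q\<^sup>T\<close>, where \<open>z\<^sub>k = s\<^sub>k - H\<^sub>0 y\<^sub>k\<close>.
  On the other hand the new last column of \<open>C\<close> consists of the numbers \<open>z\<^sub>i \<bullet> y\<^sub>k\<close>, which is exactly what
  turns \<open>P Q Z\<^sup>T\<close> into \<open>P Q Z\<^sup>T - P Q (Z\<^sup>T y\<^sub>k) q\<^sup>T = P (Q Z\<^sup>T) P\<^sup>T\<close>. Hence the two sides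
  grow by the same rule (\<open>form_of_projected_family\<close>).
\<close>

section \<open>The update as a sum of rank-one terms\<close>

lemma qn_update_carrier:
  assumes "H \<in> carrier_mat d d" "s \<in> carrier_vec d" "y \<in> carrier_vec d" "v \<in> carrier_vec d"
  shows "qn_update H s y v \<in> carrier_mat d d"
  using assms by (auto simp: qn_update_def Let_def outer_prod_def)

text \<open>
  Scaling \<open>v\<close> to \<open>q\<close> with \<open>q \<bullet> y = 1\<close> absorbs both denominators of the update.
\<close>

lemma qn_update_entry:
  assumes "H \<in> carrier_mat d d" "s \<in> carrier_vec d" "y \<in> carrier_vec d" "v \<in> carrier_vec d"
    and "a < d" "b < d"
  defines "r \<equiv> s - H *\<^sub>v y" and "q \<equiv> (1 / (v \<bullet> y)) \<cdot>\<^sub>v v"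
  shows "qn_update H s y v $$ (a, b) =
    H $$ (a, b) + (r $ a * q $ b + q $ a * r $ b) - (r \<bullet> y) * (q $ a * q $ b)"
proof -
  have "r \<in> carrier_vec d"
    using assms by auto
  then show ?thesis
    using assms(1-6)
    by (simp add: qn_update_def Let_def outer_prod_def r_def[symmetric] q_def power2_eq_square
        algebra_simps add_divide_distrib)
qed

section \<open>The compact form in terms of a dual family\<close>

text \<open>
  This is the algebra behind one induction step, read off at one matrix entry \<open>(a, b)\<close>: the numbers
  \<open>Qa i\<close>, \<open>Qb i\<close> are the entries of a vector \<open>Q\<^sub>i\<close> at \<open>a\<close> and \<open>b\<close>, and likewise for \<open>z\<^sub>i\<close> and \<open>q\<close>. The
  coefficients are \<open>t\<^sub>i = Q\<^sub>i \<bullet> y\<close> and \<open>c\<^sub>i = z\<^sub>i \<bullet> y\<close>. With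
  \<open>\<Delta> = \<Sum>\<^sub>i (Q\<^sub>i z\<^sub>i\<^sup>T + z\<^sub>i Q\<^sub>i\<^sup>T) - \<Sum>\<^sub>i\<^sub>j C\<^sub>i\<^sub>j Q\<^sub>i Q\<^sub>j\<^sup>T\<close>, the right-hand side is the entry of
  \<open>\<Delta> - (\<Delta> y) q\<^sup>T - q (\<Delta> y)\<^sup>T + (y\<^sup>T \<Delta> y) q q\<^sup>T\<close>, that is, of \<open>(I - q y\<^sup>T) \<Delta> (I - q y\<^sup>T)\<^sup>T\<close>. On the
  left only the \<open>Q\<^sub>i\<close> are projected; the sum with the coefficients \<open>c\<^sub>i\<close> supplies what projecting the
  \<open>z\<^sub>i\<close> would have contributed.
\<close>

lemma form_of_projected_family:
  fixes Qa Qb za zb c t :: "nat \<Rightarrow> real" and C :: "nat \<Rightarrow> nat \<Rightarrow> real"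
  assumes sym: "\<And>i j. C i j = C j i"
  shows
    "(\<Sum>i<k. (Qa i - t i * qa) * zb i + za i * (Qb i - t i * qb))
      - (\<Sum>i<k. \<Sum>j<k. C i j * (Qa i - t i * qa) * (Qb j - t j * qb))
      - (\<Sum>i<k. c i * ((Qa i - t i * qa) * qb + qa * (Qb i - t i * qb)))
   = (\<Sum>i<k. Qa i * zb i + za i * Qb i) - (\<Sum>i<k. \<Sum>j<k. C i j * Qa i * Qb j)
      - ((\<Sum>i<k. Qa i * c i + za i * t i) - (\<Sum>i<k. \<Sum>j<k. C i j * Qa i * t j)) * qb
      - qa * ((\<Sum>i<k. Qb i * c i + zb i * t i) - (\<Sum>i<k. \<Sum>j<k. C i j * Qb i * t j))
      + ((\<Sum>i<k. t i * c i + c i * t i) - (\<Sum>i<k. \<Sum>j<k. C i j * t i * t j)) * (qa * qb)"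
proof -
  have swap: "(\<Sum>i<k. \<Sum>j<k. C i j * Qb i * t j) = (\<Sum>i<k. \<Sum>j<k. C i j * t i * Qb j)"
    by (subst sum.swap) (simp add: sym mult_ac)
  show ?thesis
    unfolding swap
    by (simp add: algebra_simps sum.distrib sum_subtractf sum_distrib_left sum_distrib_right)
qed

lemma scalar_prod_lessThan:
  assumes "y \<in> carrier_vec d"
  shows "x \<bullet> y = (\<Sum>b<d. x $ b * y $ b)"
  using assms by (simp add: scalar_prod_def lessThan_atLeast0)

text \<open>
  The equations for the \<open>v\<^sub>i\<close> are \<open>Q U\<^sup>T = V\<close> read columnwise, so that the \<open>Q\<^sub>i\<close> are the columns of
  \<open>V U\<^sup>-\<^sup>T\<close>, described without an inverse. The matrix \<open>C\<close> is symmetric by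
  construction: an entry pairs the residual with the smaller index with the later \<open>y\<close>, because
  the vector \<open>y\<^sub>k\<close> of a new step meets the residuals of all earlier steps. The proof is an induction in
  which every old \<open>Q\<^sub>i\<close> is projected along \<open>q\<close> onto the vectors orthogonal to \<open>y\<^sub>k\<close>, and \<open>q\<close> itself
  is added as the new member.
\<close>

lemma compact_form_by_dual_vectors:
  fixes s y v :: "nat \<Rightarrow> real vec" and H :: "nat \<Rightarrow> real mat"
  assumes H0: "H 0 \<in> carrier_mat d d"
    and "\<And>i. i < k \<Longrightarrow> s i \<in> carrier_vec d"
    and "\<And>i. i < k \<Longrightarrow> y i \<in> carrier_vec d"
    and "\<And>i. i < k \<Longrightarrow> v i \<in> carrier_vec d"
    and "\<And>i. i < k \<Longrightarrow> v i \<bullet> y i \<noteq> 0"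
    and "\<And>i. i < k \<Longrightarrow> H (Suc i) = qn_update (H i) (s i) (y i) (v i)"
  defines "z \<equiv> \<lambda>i. s i - H 0 *\<^sub>v y i"
  defines "C \<equiv> \<lambda>i j. if i \<le> j then z i \<bullet> y j else z j \<bullet> y i"
  shows "H k \<in> carrier_mat d d \<and>
    (\<exists>Q. (\<forall>i<k. Q i \<in> carrier_vec d) \<and>
      (\<forall>i<k. \<forall>a<d. v i $ a = (\<Sum>j<k. (if i \<le> j then v i \<bullet> y j else 0) * Q j $ a)) \<and>
      (\<forall>a<d. \<forall>b<d. H k $$ (a, b) = H 0 $$ (a, b)
          + (\<Sum>i<k. Q i $ a * z i $ b + z i $ a * Q i $ b)
          - (\<Sum>i<k. \<Sum>j<k. C i j * Q i $ a * Q j $ b)))"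
  using assms(2-6)
proof (induction k)
  case 0
  then show ?case using H0 by auto
next
  case (Suc k)
  have s: "\<And>i. i \<le> k \<Longrightarrow> s i \<in> carrier_vec d" and y: "\<And>i. i \<le> k \<Longrightarrow> y i \<in> carrier_vec d"
    and v: "\<And>i. i \<le> k \<Longrightarrow> v i \<in> carrier_vec d" and vy: "v k \<bullet> y k \<noteq> 0"
    and step: "H (Suc k) = qn_update (H k) (s k) (y k) (v k)"
    using Suc.prems by auto
  obtain Q where Hk: "H k \<in> carrier_mat d d"
    and Q: "\<And>i. i < k \<Longrightarrow> Q i \<in> carrier_vec d"
    and dual: "\<And>i a. i < k \<Longrightarrow> a < d \<Longrightarrow>
        v i $ a = (\<Sum>j<k. (if i \<le> j then v i \<bullet> y j else 0) * Q j $ a)"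
    and form: "\<And>a b. a < d \<Longrightarrow> b < d \<Longrightarrow> H k $$ (a, b) = H 0 $$ (a, b)
          + (\<Sum>i<k. Q i $ a * z i $ b + z i $ a * Q i $ b)
          - (\<Sum>i<k. \<Sum>j<k. C i j * Q i $ a * Q j $ b)"
  proof -
    have "H k \<in> carrier_mat d d \<and>
      (\<exists>Q. (\<forall>i<k. Q i \<in> carrier_vec d) \<and>
        (\<forall>i<k. \<forall>a<d. v i $ a = (\<Sum>j<k. (if i \<le> j then v i \<bullet> y j else 0) * Q j $ a)) \<and>
        (\<forall>a<d. \<forall>b<d. H k $$ (a, b) = H 0 $$ (a, b)
          + (\<Sum>i<k. Q i $ a * z i $ b + z i $ a * Q i $ b)
          - (\<Sum>i<k. \<Sum>j<k. C i j * Q i $ a * Q j $ b)))"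
      by (rule Suc.IH) (rule Suc.prems, rule less_SucI, assumption)+
    then show ?thesis
      by (elim conjE exE) (rule that, simp_all (no_asm_simp))
  qed
  have z: "\<And>i. i \<le> k \<Longrightarrow> z i \<in> carrier_vec d"
    using H0 s y by (auto simp: z_def)
  have C_sym: "C i j = C j i" for i j
    by (auto simp: C_def)
  define q where "q = (1 / (v k \<bullet> y k)) \<cdot>\<^sub>v v k"
  define t where "t = (\<lambda>i. Q i \<bullet> y k)"
  define Q' where "Q' = (\<lambda>i. if i = k then q else Q i - t i \<cdot>\<^sub>v q)"
  have q: "q \<in> carrier_vec d"
    using v by (simp add: q_def)
  have Q': "\<forall>i<Suc k. Q' i \<in> carrier_vec d"
    using Q q by (auto simp: Q'_def less_Suc_eq)
  have Q'_entry: "Q' i $ a = Q i $ a - t i * q $ a" if "i < k" "a < d" for i a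
    using that Q[of i] q by (simp add: Q'_def)
  have Q'_last: "Q' k = q"
    by (simp add: Q'_def)
  \<comment> \<open>An old equation for \<open>v\<^sub>i\<close> survives because the multiples of \<open>q\<close> that the projection removes
    add up to \<open>v\<^sub>i \<bullet> y\<^sub>k\<close>, which is the new coefficient of \<open>q\<close>.\<close>
  have dual': "v i $ a = (\<Sum>j<Suc k. (if i \<le> j then v i \<bullet> y j else 0) * Q' j $ a)"
    if i: "i < Suc k" and a: "a < d" for i a
  proof (cases "i = k")
    case True
    have "(\<Sum>j<k. (if k \<le> j then v k \<bullet> y j else 0) * Q' j $ a) = 0"
      by (intro sum.neutral) auto
    then show ?thesis
      using True a v[of k] vy by (simp add: Q'_last q_def)
  next
    case False
    with i have i: "i < k" by simp
    define u where "u = (\<lambda>j. if i \<le> j then v i \<bullet> y j else 0)"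
    have "v i \<bullet> y k = (\<Sum>b<d. (\<Sum>j<k. u j * Q j $ b) * y k $ b)"
      using y[of k] dual[OF i] by (simp add: scalar_prod_lessThan[of _ d] u_def)
    also have "\<dots> = (\<Sum>j<k. u j * t j)"
      using y[of k]
      by (subst sum_distrib_right, subst sum.swap)
        (simp add: t_def scalar_prod_lessThan[of _ d] sum_distrib_left mult.assoc)
    finally have "v i \<bullet> y k = (\<Sum>j<k. u j * t j)" .
    moreover have "(\<Sum>j<k. u j * Q' j $ a)
        = (\<Sum>j<k. u j * Q j $ a) - (\<Sum>j<k. u j * t j) * q $ a"
      using a by (simp add: Q'_entry algebra_simps sum_subtractf sum_distrib_left)
    moreover have "v i $ a = (\<Sum>j<k. u j * Q j $ a)"
      using dual[OF i a] by (simp add: u_def)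
    ultimately have "v i $ a = (\<Sum>j<Suc k. u j * Q' j $ a)"
      using i by (simp add: Q'_last) (simp add: u_def)
    then show ?thesis by (simp add: u_def)
  qed
  \<comment> \<open>For \<open>\<Delta> = H\<^sub>k - H\<^sub>0\<close>, the vector \<open>\<Delta> y\<^sub>k\<close> is \<open>\<alpha>\<close> and the number \<open>y\<^sub>k\<^sup>T \<Delta> y\<^sub>k\<close> is \<open>\<kappa>\<close>.\<close>
  define \<alpha> where "\<alpha> = (\<lambda>a. (\<Sum>i<k. Q i $ a * C i k + z i $ a * t i)
      - (\<Sum>i<k. \<Sum>j<k. C i j * Q i $ a * t j))"
  define \<kappa> where "\<kappa> = (\<Sum>i<k. t i * C i k + C i k * t i) - (\<Sum>i<k. \<Sum>j<k. C i j * t i * t j)"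
  have c: "C i k = (\<Sum>b<d. z i $ b * y k $ b)" if "i < k" for i
    using that y[of k] by (simp add: C_def scalar_prod_lessThan)
  have t: "t i = (\<Sum>b<d. Q i $ b * y k $ b)" for i
    using y[of k] by (simp add: t_def scalar_prod_lessThan)
  have \<alpha>: "(\<Sum>b<d. ((\<Sum>i<k. Q i $ a * z i $ b + z i $ a * Q i $ b)
          - (\<Sum>i<k. \<Sum>j<k. C i j * Q i $ a * Q j $ b)) * y k $ b) = \<alpha> a" for a
  proof -
    have 1: "(\<Sum>b<d. (\<Sum>i<k. Q i $ a * z i $ b + z i $ a * Q i $ b) * y k $ b)
      = (\<Sum>i<k. Q i $ a * C i k + z i $ a * t i)"
      by (subst sum_distrib_right, subst sum.swap)
        (simp add: c t algebra_simps sum.distrib sum_distrib_left)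
    have 2: "(\<Sum>b<d. (\<Sum>i<k. \<Sum>j<k. C i j * Q i $ a * Q j $ b) * y k $ b)
      = (\<Sum>i<k. \<Sum>j<k. C i j * Q i $ a * t j)"
      by (subst sum_distrib_right, subst sum.swap, subst sum_distrib_right, subst sum.swap)
        (simp add: t sum_distrib_left mult.assoc)
    show ?thesis
      using 1 2 by (simp add: \<alpha>_def left_diff_distrib sum_subtractf)
  qed
  have \<kappa>: "(\<Sum>a<d. \<alpha> a * y k $ a) = \<kappa>"
  proof -
    have 1: "(\<Sum>a<d. (\<Sum>i<k. Q i $ a * C i k + z i $ a * t i) * y k $ a)
      = (\<Sum>i<k. t i * C i k + C i k * t i)"
    proof -
      have "(\<Sum>a<d. (\<Sum>i<k. Q i $ a * C i k + z i $ a * t i) * y k $ a)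
        = (\<Sum>i<k. \<Sum>a<d. (Q i $ a * y k $ a) * C i k + (z i $ a * y k $ a) * t i)"
        by (subst sum_distrib_right, subst sum.swap) (simp add: algebra_simps)
      also have "\<dots> = (\<Sum>i<k. t i * C i k + (\<Sum>a<d. z i $ a * y k $ a) * t i)"
        by (simp only: sum.distrib sum_distrib_right[symmetric] t[symmetric])
      finally show ?thesis by (simp add: c)
    qed
    have 2: "(\<Sum>a<d. (\<Sum>i<k. \<Sum>j<k. C i j * Q i $ a * t j) * y k $ a)
      = (\<Sum>i<k. \<Sum>j<k. C i j * t i * t j)"
    proof -
      have "(\<Sum>a<d. (\<Sum>i<k. \<Sum>j<k. C i j * Q i $ a * t j) * y k $ a)
        = (\<Sum>i<k. \<Sum>j<k. \<Sum>a<d. C i j * t j * (Q i $ a * y k $ a))"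
        by (subst sum_distrib_right, subst sum.swap, subst sum_distrib_right, subst sum.swap)
          (simp add: mult_ac)
      also have "\<dots> = (\<Sum>i<k. \<Sum>j<k. C i j * t j * t i)"
        by (simp only: sum_distrib_left[symmetric] t[symmetric])
      finally show ?thesis by (simp add: mult_ac)
    qed
    show ?thesis
      using 1 2 by (simp add: \<alpha>_def \<kappa>_def left_diff_distrib sum_subtractf)
  qed
  \<comment> \<open>The residual of the current matrix differs from the residual of the initial one by \<open>\<Delta> y\<^sub>k\<close>.\<close>
  define r where "r = s k - H k *\<^sub>v y k"
  have r: "r $ a = z k $ a - \<alpha> a" if a: "a < d" for a
  proof -
    have "(H k *\<^sub>v y k) $ a = (\<Sum>b<d. H k $$ (a, b) * y k $ b)"
      using Hk y[of k] a by (simp add: scalar_prod_lessThan[of _ d])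
    also have "\<dots> = (\<Sum>b<d. H 0 $$ (a, b) * y k $ b) + \<alpha> a"
      unfolding \<alpha>[of a, symmetric] using a
      by (simp add: form algebra_simps sum.distrib sum_subtractf)
    also have "(\<Sum>b<d. H 0 $$ (a, b) * y k $ b) = (H 0 *\<^sub>v y k) $ a"
      using H0 y[of k] a by (simp add: scalar_prod_lessThan[of _ d])
    finally show ?thesis
      using a Hk H0 s[of k] y[of k] by (simp add: r_def z_def)
  qed
  have ry: "r \<bullet> y k = C k k - \<kappa>"
    using y[of k] r
    by (simp add: scalar_prod_lessThan[of _ d] C_def \<kappa>[symmetric] left_diff_distrib sum_subtractf)
  have form': "H (Suc k) $$ (a, b) = H 0 $$ (a, b)
          + (\<Sum>i<Suc k. Q' i $ a * z i $ b + z i $ a * Q' i $ b)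
          - (\<Sum>i<Suc k. \<Sum>j<Suc k. C i j * Q' i $ a * Q' j $ b)" if a: "a < d" and b: "b < d" for a b
  proof -
    have "H (Suc k) $$ (a, b) = H k $$ (a, b) + (r $ a * q $ b + q $ a * r $ b)
        - (r \<bullet> y k) * (q $ a * q $ b)"
      unfolding step r_def q_def
      by (rule qn_update_entry) (use Hk s y v a b in auto)
    also have "\<dots> = H 0 $$ (a, b)
          + ((\<Sum>i<k. Q i $ a * z i $ b + z i $ a * Q i $ b)
          - (\<Sum>i<k. \<Sum>j<k. C i j * Q i $ a * Q j $ b)
          - \<alpha> a * q $ b - q $ a * \<alpha> b + \<kappa> * (q $ a * q $ b))
          + q $ a * z k $ b + z k $ a * q $ b - C k k * q $ a * q $ b"
      using a b by (simp add: form r ry algebra_simps)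
    also have "\<dots> = H 0 $$ (a, b)
          + ((\<Sum>i<k. Q' i $ a * z i $ b + z i $ a * Q' i $ b)
          - (\<Sum>i<k. \<Sum>j<k. C i j * Q' i $ a * Q' j $ b)
          - (\<Sum>i<k. C i k * (Q' i $ a * q $ b + q $ a * Q' i $ b)))
          + q $ a * z k $ b + z k $ a * q $ b - C k k * q $ a * q $ b"
      unfolding \<alpha>_def \<kappa>_def
      by (subst form_of_projected_family[OF C_sym, symmetric]) (simp add: Q'_entry a b)
    also have "\<dots> = H 0 $$ (a, b)
          + (\<Sum>i<Suc k. Q' i $ a * z i $ b + z i $ a * Q' i $ b)
          - (\<Sum>i<Suc k. \<Sum>j<Suc k. C i j * Q' i $ a * Q' j $ b)"
    proof -
      have "C k j = C j k" if "j < k" for j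
        by (rule C_sym)
      then show ?thesis
        by (simp add: Q'_last sum.distrib algebra_simps)
    qed
    finally show ?thesis .
  qed
  have "H (Suc k) \<in> carrier_mat d d"
    unfolding step by (rule qn_update_carrier) (use Hk s y v in auto)
  then show ?case
    using Q' dual' form' by blast
qed

section \<open>Inverting the middle matrix\<close>

lemma inv_mat_eqI:
  assumes M: "M \<in> carrier_mat n n" and N: "N \<in> carrier_mat n n" and MN: "M * N = 1\<^sub>m n"
  shows "invertible_mat M" "inv_mat M = N"
proof -
  have NM: "N * M = 1\<^sub>m n"
    by (rule mat_mult_left_right_inverse[OF M N MN])
  show "invertible_mat M"
    using M N MN NM unfolding invertible_mat_def inverts_mat_def by auto
  have "M \<in> Units (ring_mat TYPE(real) n ())"
    using M N MN NM by (auto simp: Units_def ring_mat_simps)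
  then obtain B where B: "mat_inverse M = Some B"
    using mat_inverse(1)[OF M, where b = "()"] by (cases "mat_inverse M") auto
  from mat_inverse(2)[OF M B] have "B * M = 1\<^sub>m n" "B \<in> carrier_mat n n" by auto
  then have "B = N"
    using M N MN by (metis assoc_mult_mat left_mult_one_mat right_mult_one_mat)
  then show "inv_mat M = N"
    by (simp add: inv_mat_def B)
qed

text \<open>
  The zero block makes elimination explicit: the first block row forces the lower row of the inverse to
  be \<open>(B, 0)\<close>, and then the second block row is solved for the upper one by \<open>(U\<^sup>T)\<^sup>-\<^sup>1 = B\<^sup>T\<close>.
\<close>

lemma saddle_block_right_inverse:
  fixes U B C :: "real mat"
  assumes U: "U \<in> carrier_mat k k" and B: "B \<in> carrier_mat k k" and C: "C \<in> carrier_mat k k"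
    and UB: "U * B = 1\<^sub>m k"
  shows "four_block_mat (0\<^sub>m k k) U (U\<^sup>T) C
      * four_block_mat (- (B\<^sup>T * C * B)) (B\<^sup>T) B (0\<^sub>m k k) = 1\<^sub>m (k + k)"
proof -
  have BU: "B * U = 1\<^sub>m k"
    by (rule mat_mult_left_right_inverse[OF U B UB])
  then have UTBT: "U\<^sup>T * B\<^sup>T = 1\<^sub>m k"
    using transpose_mult[OF B U] by simp
  have "U\<^sup>T * (B\<^sup>T * C * B) = U\<^sup>T * B\<^sup>T * (C * B)"
    using U B C by (simp add: assoc_mult_mat[of _ k k _ k _ k])
  also have "\<dots> = C * B"
    using B C by (simp add: UTBT)
  finally have "U\<^sup>T * (- (B\<^sup>T * C * B)) + C * B = 0\<^sub>m k k"
    using U B C by (simp add: uminus_l_inv_mat)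
  moreover have "- 0\<^sub>m k k + 1\<^sub>m k = (1\<^sub>m k :: real mat)"
    by (rule eq_matI) auto
  ultimately show ?thesis
    using U B C UB UTBT
    by (subst mult_four_block_mat[of _ k k _ k _ k _ _ k _ k]) auto
qed

lemma upper_triangular_inverse:
  fixes U :: "real mat"
  assumes U: "U \<in> carrier_mat k k" and "upper_triangular U" and "\<And>i. i < k \<Longrightarrow> U $$ (i, i) \<noteq> 0"
  obtains B where "B \<in> carrier_mat k k" "U * B = 1\<^sub>m k"
proof -
  have "det U \<noteq> 0"
    using assms by (auto simp: det_upper_triangular prod_list_zero_iff diag_mat_def)
  then have "U \<in> Units (ring_mat TYPE(real) k ())"
    by (rule det_non_zero_imp_unit[OF U])
  then show ?thesis
    using that by (auto simp: Units_def ring_mat_simps)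
qed

lemma bordered_product:
  fixes V Z N1 N2 N3 N4 :: "real mat"
  assumes "V \<in> carrier_mat d k" "Z \<in> carrier_mat d k"
    "N1 \<in> carrier_mat k k" "N2 \<in> carrier_mat k k" "N3 \<in> carrier_mat k k" "N4 \<in> carrier_mat k k"
  shows "(V @\<^sub>c Z) * four_block_mat N1 N2 N3 N4 * (V\<^sup>T @\<^sub>r Z\<^sup>T)
    = (V * N1 + Z * N3) * V\<^sup>T + (V * N2 + Z * N4) * Z\<^sup>T"
proof -
  have 1: "(V @\<^sub>c Z) * four_block_mat N1 N2 N3 N4
    = four_block_mat (V * N1 + Z * N3) (V * N2 + Z * N4) (0\<^sub>m 0 k) (0\<^sub>m 0 k)"
    unfolding append_cols_def using assms
    by (subst mult_four_block_mat[of _ d k _ k _ 0 _ _ k _ k]) auto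
  have 2: "\<dots> * (V\<^sup>T @\<^sub>r Z\<^sup>T)
     = four_block_mat ((V * N1 + Z * N3) * V\<^sup>T + (V * N2 + Z * N4) * Z\<^sup>T) (0\<^sub>m d 0) (0\<^sub>m 0 d) (0\<^sub>m 0 0)"
    unfolding append_rows_def using assms
    by (subst mult_four_block_mat[of _ d k _ k _ 0 _ _ d _ 0]) auto
  show ?thesis unfolding 1 2
    by (rule eq_matI) (use assms in auto)
qed

section \<open>The compact representation\<close>

theorem theorem3p1:
  fixes d k :: nat
    and w g s y v :: "nat \<Rightarrow> real vec"
    and H :: "nat \<Rightarrow> real mat"
  assumes "d \<ge> 1" and "k \<ge> 1"
    and "H 0 \<in> carrier_mat d d" and "(H 0)\<^sup>T = H 0"
    and "\<And>i. i \<le> k \<Longrightarrow> w i \<in> carrier_vec d"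
    and "\<And>i. i \<le> k \<Longrightarrow> g i \<in> carrier_vec d"
    and "\<And>i. i < k \<Longrightarrow> s i = w (Suc i) - w i"
    and "\<And>i. i < k \<Longrightarrow> y i = g (Suc i) - g i"
    and "\<And>i. i < k \<Longrightarrow> v i \<in> carrier_vec d"
    and "\<And>i. i < k \<Longrightarrow> v i \<bullet> y i \<noteq> 0"
    and "\<And>i. i < k \<Longrightarrow> H (Suc i) = qn_update (H i) (s i) (y i) (v i)"
  shows "let S = mat_of_cols d (map s [0..<k]);
             Y = mat_of_cols d (map y [0..<k]);
             V = mat_of_cols d (map v [0..<k]);
             D = mat_diag k (\<lambda>i. s i \<bullet> y i);
             R = upper_part (S\<^sup>T * Y);
             RVY = upper_part (V\<^sup>T * Y);
             M = four_block_mat (0\<^sub>m k k) RVY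
                   (RVY\<^sup>T) (R + R\<^sup>T - (D + Y\<^sup>T * H 0 * Y))
         in invertible_mat M \<and>
            H k = H 0 + (V @\<^sub>c (S - H 0 * Y)) * inv_mat M * (V\<^sup>T @\<^sub>r (S - H 0 * Y)\<^sup>T)"
proof -
  define S where "S = mat_of_cols d (map s [0..<k])"
  define Y where "Y = mat_of_cols d (map y [0..<k])"
  define V where "V = mat_of_cols d (map v [0..<k])"
  define U where "U = upper_part (V\<^sup>T * Y)"
  define R where "R = upper_part (S\<^sup>T * Y)"
  define C where "C = R + R\<^sup>T - (mat_diag k (\<lambda>i. s i \<bullet> y i) + Y\<^sup>T * H 0 * Y)"
  define Z where "Z = S - H 0 * Y"
  define z where "z = (\<lambda>i. s i - H 0 *\<^sub>v y i)"
  have H0: "H 0 \<in> carrier_mat d d" and H0_sym: "(H 0)\<^sup>T = H 0"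
    using assms by auto
  have s: "s i \<in> carrier_vec d" and y: "y i \<in> carrier_vec d" and v: "v i \<in> carrier_vec d"
    and vy: "v i \<bullet> y i \<noteq> 0" and z: "z i \<in> carrier_vec d" if "i < k" for i
    using that assms by (auto simp: z_def)
  have S: "S \<in> carrier_mat d k" and Y: "Y \<in> carrier_mat d k" and V: "V \<in> carrier_mat d k"
    by (auto simp: S_def Y_def V_def)
  have S_col: "col S i = s i" and Y_col: "col Y i = y i" and V_col: "col V i = v i" if "i < k" for i
    using that s y v by (auto simp: S_def Y_def V_def)
  have U: "U \<in> carrier_mat k k" and R: "R \<in> carrier_mat k k"
    using S Y V by (auto simp: U_def R_def upper_part_def)
  have C: "C \<in> carrier_mat k k" and Z: "Z \<in> carrier_mat d k"
    using R S Y H0 by (auto simp: C_def Z_def)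
  have U_entry: "U $$ (i, j) = (if i \<le> j then v i \<bullet> y j else 0)" if "i < k" "j < k" for i j
    using that V Y by (simp add: U_def upper_part_def V_col Y_col)
  have R_entry: "R $$ (i, j) = (if i \<le> j then s i \<bullet> y j else 0)" if "i < k" "j < k" for i j
    using that S Y by (simp add: R_def upper_part_def S_col Y_col)
  have Z_entry: "Z $$ (a, i) = z i $ a" if "a < d" "i < k" for a i
  proof -
    have "S $$ (a, i) = s i $ a"
      using that S S_col[of i] by (metis carrier_matD index_col)
    then show ?thesis
      using that S Y H0 s[of i] y[of i] by (simp add: Z_def z_def Y_col)
  qed
  have YHY_entry: "(Y\<^sup>T * H 0 * Y) $$ (i, j) = (H 0 *\<^sub>v y i) \<bullet> y j" if "i < k" "j < k" for i j
  proof -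
    have "Y\<^sup>T * H 0 = (H 0 * Y)\<^sup>T"
      using Y H0 H0_sym by (simp add: transpose_mult[of _ d d _ k])
    then show ?thesis
      using that Y H0 by (simp add: Y_col del: transpose_mult)
  qed
  have HY_sym: "(H 0 *\<^sub>v y i) \<bullet> y j = (H 0 *\<^sub>v y j) \<bullet> y i" if "i < k" "j < k" for i j
    using transpose_vec_mult_scalar[OF H0 y[OF that(1)] y[OF that(2)]] H0 H0_sym
      y[OF that(1)] y[OF that(2)] by (simp add: comm_scalar_prod[of "y j" d])
  \<comment> \<open>On the diagonal \<open>s\<^sub>i \<bullet> y\<^sub>i\<close> occurs in both \<open>R\<close> and its transpose; the diagonal
    matrix removes one copy. Symmetry of \<open>H\<^sub>0\<close> gives the entries below the diagonal.\<close>
  have C_entry: "C $$ (i, j) = (if i \<le> j then z i \<bullet> y j else z j \<bullet> y i)"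
    if ij: "i < k" "j < k" for i j
  proof -
    have z_y: "z i \<bullet> y j = s i \<bullet> y j - (H 0 *\<^sub>v y i) \<bullet> y j" if "i < k" "j < k" for i j
      using that H0 s y by (simp add: z_def minus_scalar_prod_distrib[of _ d])
    have "C $$ (i, j) = R $$ (i, j) + R $$ (j, i) - ((if i = j then s i \<bullet> y i else 0)
        + (Y\<^sup>T * H 0 * Y) $$ (i, j))"
      using ij R Y H0 by (simp add: C_def mat_diag_def)
    then show ?thesis
      using ij HY_sym[of i j] by (auto simp: R_entry YHY_entry z_y)
  qed
  obtain B where B: "B \<in> carrier_mat k k" and UB: "U * B = 1\<^sub>m k"
    by (rule upper_triangular_inverse[OF U]) (use U U_entry vy in \<open>auto simp: upper_triangular_def\<close>)
  have UTBT: "U\<^sup>T * B\<^sup>T = 1\<^sub>m k"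
    using transpose_mult[OF B U] mat_mult_left_right_inverse[OF U B UB] by simp
  obtain q where Hk: "H k \<in> carrier_mat d d"
    and dual: "\<And>i a. i < k \<Longrightarrow> a < d \<Longrightarrow>
        v i $ a = (\<Sum>j<k. (if i \<le> j then v i \<bullet> y j else 0) * q j $ a)"
    and form: "\<And>a b. a < d \<Longrightarrow> b < d \<Longrightarrow> H k $$ (a, b) = H 0 $$ (a, b)
          + (\<Sum>i<k. q i $ a * z i $ b + z i $ a * q i $ b)
          - (\<Sum>i<k. \<Sum>j<k. (if i \<le> j then z i \<bullet> y j else z j \<bullet> y i) * q i $ a * q j $ b)"
  proof -
    have "H k \<in> carrier_mat d d \<and>
      (\<exists>q. (\<forall>i<k. q i \<in> carrier_vec d) \<and>
        (\<forall>i<k. \<forall>a<d. v i $ a = (\<Sum>j<k. (if i \<le> j then v i \<bullet> y j else 0) * q j $ a)) \<and>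
        (\<forall>a<d. \<forall>b<d. H k $$ (a, b) = H 0 $$ (a, b)
          + (\<Sum>i<k. q i $ a * z i $ b + z i $ a * q i $ b)
          - (\<Sum>i<k. \<Sum>j<k. (if i \<le> j then z i \<bullet> y j else z j \<bullet> y i) * q i $ a * q j $ b)))"
      unfolding z_def
      by (rule compact_form_by_dual_vectors) (fact H0 | rule s y v vy assms(11), assumption)+
    then show ?thesis
      by (elim conjE exE) (rule that, simp_all (no_asm_simp))
  qed
  \<comment> \<open>Invertibility of \<open>U\<close> identifies the dual family with the columns of \<open>V B\<^sup>T\<close>.\<close>
  define Q where "Q = mat d k (\<lambda>(a, i). q i $ a)"
  have Q: "Q \<in> carrier_mat d k"
    by (simp add: Q_def)
  have "Q * U\<^sup>T = V"
  proof (rule eq_matI)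
    fix a i assume "a < dim_row V" "i < dim_col V"
    then have a: "a < d" and i: "i < k" using V by auto
    have "V $$ (a, i) = v i $ a"
      using a i V V_col[of i] by (metis carrier_matD index_col)
    then show "(Q * U\<^sup>T) $$ (a, i) = V $$ (a, i)"
      using a i U by (simp add: Q_def scalar_prod_def U_entry dual lessThan_atLeast0 mult.commute)
  qed (use Q U V in auto)
  then have "V * B\<^sup>T = Q * (U\<^sup>T * B\<^sup>T)"
    using Q U B by (simp add: assoc_mult_mat[of Q d k "U\<^sup>T" k "B\<^sup>T" k, symmetric])
  then have VB: "V * B\<^sup>T = Q"
    using Q by (simp add: UTBT)
  have BV: "B * V\<^sup>T = Q\<^sup>T"
    using V B by (simp add: VB[symmetric] transpose_mult[of _ d k _ k])
  have H_form: "H k = H 0 + ((Z * Q\<^sup>T - Q * C * Q\<^sup>T) + Q * Z\<^sup>T)"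
  proof (rule eq_matI)
    fix a b
    assume "a < dim_row (H 0 + ((Z * Q\<^sup>T - Q * C * Q\<^sup>T) + Q * Z\<^sup>T))"
      "b < dim_col (H 0 + ((Z * Q\<^sup>T - Q * C * Q\<^sup>T) + Q * Z\<^sup>T))"
    then have a: "a < d" and b: "b < d" using Q Z by auto
    have "(Q * C * Q\<^sup>T) $$ (a, b)
        = (\<Sum>j<k. (\<Sum>i<k. q i $ a * C $$ (i, j)) * q j $ b)"
      using a b Q C by (simp add: scalar_prod_def Q_def lessThan_atLeast0)
    also have "\<dots> = (\<Sum>i<k. \<Sum>j<k. C $$ (i, j) * q i $ a * q j $ b)"
      by (subst sum_distrib_right, subst sum.swap) (simp add: mult_ac)
    finally have "(Q * C * Q\<^sup>T) $$ (a, b)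
      = (\<Sum>i<k. \<Sum>j<k. (if i \<le> j then z i \<bullet> y j else z j \<bullet> y i) * q i $ a * q j $ b)"
      by (simp add: C_entry)
    moreover have "(Z * Q\<^sup>T) $$ (a, b) = (\<Sum>i<k. z i $ a * q i $ b)"
      "(Q * Z\<^sup>T) $$ (a, b) = (\<Sum>i<k. q i $ a * z i $ b)"
      using a b Q Z by (simp_all add: scalar_prod_def Q_def Z_entry lessThan_atLeast0)
    ultimately show "H k $$ (a, b) = (H 0 + ((Z * Q\<^sup>T - Q * C * Q\<^sup>T) + Q * Z\<^sup>T)) $$ (a, b)"
      using a b Q Z C H0 by (simp add: form sum.distrib del: index_mult_mat(1))
  qed (use Hk Q Z in auto)
  define M where "M = four_block_mat (0\<^sub>m k k) U (U\<^sup>T) C"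
  define N where "N = four_block_mat (- (B\<^sup>T * C * B)) (B\<^sup>T) B (0\<^sub>m k k)"
  have "M \<in> carrier_mat (k + k) (k + k)" "N \<in> carrier_mat (k + k) (k + k)"
    using U B C by (auto simp: M_def N_def)
  moreover have "M * N = 1\<^sub>m (k + k)"
    unfolding M_def N_def by (rule saddle_block_right_inverse[OF U B C UB])
  ultimately have M: "invertible_mat M" "inv_mat M = N"
    by (auto intro: inv_mat_eqI)
  have "(V @\<^sub>c Z) * N * (V\<^sup>T @\<^sub>r Z\<^sup>T)
      = (V * - (B\<^sup>T * C * B) + Z * B) * V\<^sup>T + (V * B\<^sup>T + Z * 0\<^sub>m k k) * Z\<^sup>T"
    unfolding N_def by (rule bordered_product) (use V Z B C in auto)
  also have "V * B\<^sup>T + Z * 0\<^sub>m k k = Q"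
    using Z Q by (simp add: VB)
  also have "V * - (B\<^sup>T * C * B) = - (Q * C * B)"
    using V B C by (simp add: VB[symmetric] assoc_mult_mat[of _ d k _ k _ k]
        assoc_mult_mat[of _ k k _ k _ k])
  also have "(- (Q * C * B) + Z * B) * V\<^sup>T = - (Q * C * Q\<^sup>T) + Z * Q\<^sup>T"
    using V B C Q Z
    by (simp add: add_mult_distrib_mat[of _ d k _ _ d] BV[symmetric]
        assoc_mult_mat[of _ d k _ k _ d])
  also have "- (Q * C * Q\<^sup>T) + Z * Q\<^sup>T = Z * Q\<^sup>T - Q * C * Q\<^sup>T"
    using Q C Z by (intro eq_matI) auto
  finally have "H k = H 0 + (V @\<^sub>c Z) * N * (V\<^sup>T @\<^sub>r Z\<^sup>T)"
    by (simp add: H_form)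
  with M show ?thesis
    unfolding Let_def M_def C_def U_def R_def Z_def S_def Y_def V_def by simp
qed

end
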